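(* Let $E_1$ and $E_2$ be complex normed spaces. For a function $f:E_1\to E_2$ the following two conditions are equivalent: (1) $\|f(x+y)-f(x)-f(y)\|\to0$ as $\|x\|+\|y\|\to\infty$; (2) $f(x+y)-f(x)-f(y)=0$ for all $x,y\in E_1$.
   Context: Condition (1) means: for every $\varepsilon>0$ there is $M>0$ such that $\|f(x+y)-f(x)-f(y)\|<\varepsilon$ for all $x,y\in E_1$ with $\|x\|+\|y\|>M$. The space $E_2$ is not assumed complete.
   Formalization: The formal theorem assumes E_1 is not {0}; for E_1 = {0} condition (1) is vacuous while (2) says f(0) = 0, so the equivalence fails for any f with f(0) nonzero. *)

theory Defs
  imports Complex_Main
begin

text \<open>
  Complex normed spaces, obtained from the real ones by adding a complex scalar multiplication
  that extends the given real one.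
\<close>

class complex_normed_vector = real_normed_vector +
  fixes scaleC :: "complex \<Rightarrow> 'a \<Rightarrow> 'a"
  assumes scaleC_add_right: "scaleC a (x + y) = scaleC a x + scaleC a y"
    and scaleC_add_left: "scaleC (a + b) x = scaleC a x + scaleC b x"
    and scaleC_scaleC: "scaleC a (scaleC b x) = scaleC (a * b) x"
    and scaleC_one: "scaleC 1 x = x"
    and scaleC_of_real: "scaleC (complex_of_real r) x = scaleR r x"
    and norm_scaleC: "norm (scaleC a x) = cmod a * norm x"

lemma vector_space_scaleC:
  "vector_space (scaleC :: complex \<Rightarrow> 'a :: complex_normed_vector \<Rightarrow> 'a)"
  by unfold_locales
    (simp_all add: scaleC_add_right scaleC_add_left scaleC_scaleC scaleC_one)

instantiation complex :: complex_normed_vector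
begin

definition scaleC_complex :: "complex \<Rightarrow> complex \<Rightarrow> complex" where
  "scaleC_complex a x = a * x"

instance
  by standard
    (simp_all add: scaleC_complex_def algebra_simps norm_mult scaleR_conv_of_real)

end

end

theory Submission
  imports Defs
begin

text \<open>
  The Cauchy difference D x y = f (x + y) - f x - f y is a cocycle:
  D x y = D x (y + z) + D y z - D (x + y) z. Letting the norm of z tend to infinity,
  which is possible in a nontrivial space, makes the right-hand side arbitrarily small.
\<close>

lemma ex_norm_eq:
  assumes "(UNIV :: 'a :: real_normed_vector set) \<noteq> {0}" and "0 \<le> r"
  shows "\<exists>z :: 'a. norm z = r"
proof -
  obtain v :: 'a where "v \<noteq> 0"
    using assms(1) by auto
  then have "norm (r *\<^sub>R sgn v) = r"
    using \<open>0 \<le> r\<close> by (simp add: norm_sgn)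
  then show ?thesis ..
qed

text \<open>If the domain is \<open>{0}\<close>, the left-hand condition is vacuous, since no pair
  satisfies \<open>norm x + norm y > M\<close> with \<open>M > 0\<close>, whereas the right-hand one
  still forces \<open>f 0 = 0\<close>; \<open>nontrivial\<close> rules this case out.\<close>

theorem theorem4p3:
  fixes f :: "'a :: complex_normed_vector \<Rightarrow> 'b :: complex_normed_vector"
  assumes nontrivial: "(UNIV :: 'a set) \<noteq> {0}"
  shows "(\<forall>\<epsilon>>0. \<exists>M>0. \<forall>x y. norm x + norm y > M \<longrightarrow>
            norm (f (x + y) - f x - f y) < \<epsilon>)
         \<longleftrightarrow> (\<forall>x y. f (x + y) - f x - f y = 0)"
proof
  assume small: "\<forall>\<epsilon>>0. \<exists>M>0. \<forall>x y. norm x + norm y > M \<longrightarrow>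
    norm (f (x + y) - f x - f y) < \<epsilon>"
  define D where "D x y = f (x + y) - f x - f y" for x y
  have "D x y = 0" for x y
  proof (rule ccontr)
    assume "D x y \<noteq> 0"
    \<comment> \<open>One third, because the cocycle identity bounds \<open>norm (D x y)\<close> by
      three small terms.\<close>
    then have "norm (D x y) / 3 > 0"
      by simp
    then obtain M where "M > 0"
      and M: "\<And>u v. norm u + norm v > M \<Longrightarrow> norm (D u v) < norm (D x y) / 3"
      using small[folded D_def] by blast
    \<comment> \<open>The summand \<open>norm y\<close> compensates for the possible cancellation in
      \<open>y + z\<close>, so that \<open>norm (y + z)\<close> is still at least
      \<open>M + 1\<close>; the \<open>1\<close> makes all three bounds strict.\<close>
    obtain z :: 'a where z: "norm z = M + norm y + 1"
      using ex_norm_eq[OF nontrivial, of "M + norm y + 1"] \<open>M > 0\<close> by auto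
    have "norm z \<le> norm (y + z) + norm y"
      using norm_triangle_ineq4[of "y + z" y] by simp
    then have "norm x + norm (y + z) > M" "norm y + norm z > M" "norm (x + y) + norm z > M"
      using z norm_ge_zero[of x] norm_ge_zero[of y] norm_ge_zero[of "x + y"] by linarith+
    then have "norm (D x (y + z)) + norm (D y z) + norm (D (x + y) z) < norm (D x y)"
      using M[of x "y + z"] M[of y z] M[of "x + y" z] by linarith
    moreover have "D x y = D x (y + z) + D y z - D (x + y) z"
      by (simp add: D_def algebra_simps)
    then have "norm (D x y) \<le> norm (D x (y + z)) + norm (D y z) + norm (D (x + y) z)"
      using norm_triangle_ineq4[of "D x (y + z) + D y z" "D (x + y) z"]
        norm_triangle_ineq[of "D x (y + z)" "D y z"] by simp
    ultimately show False
      by linarith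
  qed
  then show "\<forall>x y. f (x + y) - f x - f y = 0"
    by (simp add: D_def)
next
  assume "\<forall>x y. f (x + y) - f x - f y = 0"
  then show "\<forall>\<epsilon>>0. \<exists>M>0. \<forall>x y. norm x + norm y > M \<longrightarrow>
    norm (f (x + y) - f x - f y) < \<epsilon>"
    \<comment> \<open>The difference vanishes everywhere, so any positive \<open>M\<close> would
      serve.\<close>
    by (auto intro: exI[of _ 1])
qed

end
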